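(* Let $\mathcal{A}$ be a real tensor of order $m$ and dimension $n$ that is an almost semi-positive tensor (almost $\mathbf{E_0}$-tensor). Then every row-subtensor $R_i(\mathcal{A})$, $i\in I_n$, of $\mathcal{A}$ contains at least one negative entry.
   Context: A real tensor of order $m$ ($m\ge 2$) and dimension $n$ is an array $\mathcal{A}=(a_{i_1\ldots i_m})$ with $a_{i_1\ldots i_m}\in\mathbb{R}$, $i_1,\ldots,i_m\in I_n=\{1,\ldots,n\}$. The $i$th row-subtensor $R_i(\mathcal{A})$ is the tensor of order $m-1$ and dimension $n$ with entries $(R_i(\mathcal{A}))_{i_2\ldots i_m}=a_{ii_2\ldots i_m}$. For $\mathbf{x}\in\mathbb{R}^n$, $\mathcal{A}\mathbf{x}^{m-1}\in\mathbb{R}^n$ is defined by $(\mathcal{A}\mathbf{x}^{m-1})_i=\sum_{i_2,\ldots,i_m=1}^n a_{i i_2\ldots i_m}x_{i_2}\cdots x_{i_m}$. Vector inequalities are componentwise. For nonempty $J\subseteq I_n$, the principal subtensor of $\mathcal{A}$ indexed by $J$ is the tensor of order $m$ and dimension $|J|$ with entries $a_{i_1\ldots i_m}$, $i_1,\ldots,i_m\in J$; it is proper if $J\neq I_n$. $\mathcal{A}$ is semi-positive ($\mathbf{E_0}$-tensor) if for each $\mathbf{x}\ge\mathbf{0}$, $\mathbf{x}\ne\mathbf{0}$, there is $k\in I_n$ with $x_k>0$ and $(\mathcal{A}\mathbf{x}^{m-1})_k\ge 0$. $\mathcal{A}$ is almost semi-positive (almost $\mathbf{E_0}$-tensor) if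 every proper principal subtensor of $\mathcal{A}$ is semi-positive and there is $\mathbf{x}>\mathbf{0}$ with $\mathcal{A}\mathbf{x}^{m-1}<\mathbf{0}$. *)

theory Defs
  imports Complex_Main "HOL-Library.FuncSet"
begin

text \<open>
  A real tensor of order \<open>m\<close> whose indices range over a finite set \<open>I\<close> (so its dimension is
  \<open>card I\<close>) is a function on index lists; only its values on \<open>multi_indices m I\<close> are its entries.
  The usual dimension-\<open>n\<close> tensors have \<open>I = {1..n}\<close>. Keeping the index set as a parameter lets a
  principal subtensor retain its original indices in \<open>J\<close>. Vectors with coordinates indexed by
  \<open>I\<close> are functions \<open>'i \<Rightarrow> real\<close> of which only the values on \<open>I\<close> matter.
\<close>

type_synonym 'i tensor = "'i list \<Rightarrow> real"

definition multi_indices :: "nat \<Rightarrow> 'i set \<Rightarrow> 'i list set" where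
  "multi_indices k I = {is. set is \<subseteq> I \<and> length is = k}"

definition row_subtensor :: "'i \<Rightarrow> 'i tensor \<Rightarrow> 'i tensor" where
  "row_subtensor i A = (\<lambda>is. A (i # is))"

definition principal_subtensor :: "'i set \<Rightarrow> 'i tensor \<Rightarrow> 'i tensor" where
  "principal_subtensor J A = restrict A (lists J)"

text \<open>The \<open>i\<close>-th component of \<open>A x\<^sup>m\<^sup>-\<^sup>1\<close>.\<close>

definition tensor_apply :: "nat \<Rightarrow> 'i set \<Rightarrow> 'i tensor \<Rightarrow> ('i \<Rightarrow> real) \<Rightarrow> 'i \<Rightarrow> real" where
  "tensor_apply m I A x i = (\<Sum>is \<in> multi_indices (m - 1) I. A (i # is) * prod_list (map x is))"

definition semi_positive :: "nat \<Rightarrow> 'i set \<Rightarrow> 'i tensor \<Rightarrow> bool" where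
  "semi_positive m I A \<longleftrightarrow>
     (\<forall>x. (\<forall>i\<in>I. x i \<ge> 0) \<and> (\<exists>i\<in>I. x i \<noteq> 0) \<longrightarrow>
          (\<exists>k\<in>I. x k > 0 \<and> tensor_apply m I A x k \<ge> 0))"

definition almost_semi_positive :: "nat \<Rightarrow> 'i set \<Rightarrow> 'i tensor \<Rightarrow> bool" where
  "almost_semi_positive m I A \<longleftrightarrow>
     (\<forall>J. J \<noteq> {} \<and> J \<subset> I \<longrightarrow> semi_positive m J (principal_subtensor J A)) \<and>
     (\<exists>x. (\<forall>i\<in>I. x i > 0) \<and> (\<forall>i\<in>I. tensor_apply m I A x i < 0))"

end

theory Submission imports Defs begin

text \<open>
  Take the positive vector \<open>x\<close> witnessing almost semi-positivity. If \<open>R\<^sub>i(A)\<close> had no negative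
  entry, every summand of \<open>(A x\<^sup>m\<^sup>-\<^sup>1)\<^sub>i\<close> would be nonnegative, contradicting
  \<open>(A x\<^sup>m\<^sup>-\<^sup>1)\<^sub>i < 0\<close>.
\<close>

lemma tensor_apply_nonneg:
  assumes "\<And>i. i \<in> I \<Longrightarrow> x i \<ge> 0"
    and "\<And>is. is \<in> multi_indices (m - 1) I \<Longrightarrow> row_subtensor i A is \<ge> 0"
  shows "tensor_apply m I A x i \<ge> 0"
  unfolding tensor_apply_def
proof (rule sum_nonneg)
  fix "is" assume "is": "is \<in> multi_indices (m - 1) I"
  then have "prod_list (map x is) \<ge> 0"
    using assms(1) by (intro prod_list_nonneg) (auto simp: multi_indices_def)
  then show "A (i # is) * prod_list (map x is) \<ge> 0"
    using assms(2)[OF "is"] by (simp add: row_subtensor_def)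
qed

theorem theorem5:
  fixes m n :: nat and A :: "nat tensor"
  assumes "m \<ge> 2"
    and "almost_semi_positive m {1..n} A"
  shows "\<forall>i\<in>{1..n}. \<exists>is\<in>multi_indices (m - 1) {1..n}. row_subtensor i A is < 0"
proof (rule ballI, rule ccontr)
  fix i assume i: "i \<in> {1..n}"
    and "\<not> (\<exists>is\<in>multi_indices (m - 1) {1..n}. row_subtensor i A is < 0)"
  then have row: "\<And>is. is \<in> multi_indices (m - 1) {1..n} \<Longrightarrow> row_subtensor i A is \<ge> 0"
    by (meson not_less)
  obtain x where pos: "\<forall>j\<in>{1..n}. x j > 0"
    and neg: "\<forall>j\<in>{1..n}. tensor_apply m {1..n} A x j < 0"
    using assms(2) unfolding almost_semi_positive_def by blast
  have "tensor_apply m {1..n} A x i \<ge> 0"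
    using pos row by (intro tensor_apply_nonneg) (auto intro: less_imp_le)
  with neg i show False by (meson not_less)
qed

end
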